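(* Let $k\geq 1$ be an integer, let $s_2,s_3,\dots$ be non-negative integers, only finitely many of which are non-zero, and let $(\sigma_1,\sigma_2,q)$ be a triple such that: (a) $\sigma_1,\sigma_2\in\mathfrak{S}(k)$ and $\sigma_1\circ\sigma_2=(1,2,\dots,k)$; (b) $|C(\sigma_2)|=s_2+s_3+\cdots$; (c) $|C(\sigma_1)|+|C(\sigma_2)|=2s_2+3s_3+4s_4+\cdots$; (d) $q:C(\sigma_2)\rightarrow\{2,3,\dots\}$ is a map taking each value $i\in\{2,3,\dots\}$ exactly $s_i$ times. Then the condition (e) for every set $A\subset C(\sigma_2)$ with $A\neq\emptyset$ and $A\neq C(\sigma_2)$ there are more than $\sum_{i\in A}\big(q(i)-1\big)$ cycles of $\sigma_1$ which intersect $\bigcup A$ is equivalent to each of the following two conditions: (e$^2$) for every set $A\subset C(\sigma_2)$ with $A\neq\emptyset$ and $A\neq C(\sigma_2)$ there exist two arrangements of marriages $\mathcal{M}_1,\mathcal{M}_2:C(\sigma_1)\rightarrow C(\sigma_2)$ such that $\mathcal{M}_1^{-1}(A)\neq\mathcal{M}_2^{-1}(A)$; (e$^3$) there exists a strictly positive solution (all $x_{i,j}>0$) of the following system of equations in the variables $\{x_{i,j}: i\in C(\sigma_1)\text{ and } j\in C(\sigma_2)\text{ are intersecting cycles}\}$: $$\forall\, i\in C(\sigma_1):\ \sum_j x_{i,j}=1,\qquad \forall\, j\in C(\sigma_2):\ \sum_i x_{i,j}=q(j)-1,$$ where the sums run over those indices for which the variable $x_{i,j}$ is defined.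
   Context: $\mathfrak{S}(k)$ is the symmetric group on $\{1,\dots,k\}$. For a permutation $\pi$, $C(\pi)$ is the set of cycles of $\pi$ (fixed points count as cycles), each regarded as the set of elements it acts on; cycles intersect if they share an element, $\bigcup A$ is the union of the cycles in $A$, and a cycle intersects $\bigcup A$ if it shares an element with it. An arrangement of marriages is a map $\mathcal{M}:C(\sigma_1)\rightarrow C(\sigma_2)$ such that for each $i\in C(\sigma_1)$ the cycles $i$ and $\mathcal{M}(i)$ intersect, and for each $j\in C(\sigma_2)$ one has $|\mathcal{M}^{-1}(j)|=q(j)-1$. (Cycles of $\sigma_1$ are "boys", cycles of $\sigma_2$ are "girls", and $q(j)-1$ is the desired number of husbands of $j$.) *)

theory Defs
  imports
    Complex_Main
    "HOL-Library.FuncSet"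
    "HOL-Combinatorics.Cycles"
    "HOL-Combinatorics.Orbits"
begin

text \<open>Permutations of \<open>{1..k}\<close> are functions \<open>\<sigma>\<close> with \<open>\<sigma> permutes {1..k}\<close>. Such a function is also
  the identity outside \<open>{1..k}\<close>, so its cycles are the orbits of points of \<open>{1..k}\<close> only; fixed
  points in \<open>{1..k}\<close> yield singleton cycles.\<close>

definition cycles :: "nat \<Rightarrow> (nat \<Rightarrow> nat) \<Rightarrow> nat set set" where
  "cycles k \<sigma> = orbit \<sigma> ` {1..k}"

definition intersecting :: "nat set \<Rightarrow> nat set \<Rightarrow> bool" where
  "intersecting i j \<longleftrightarrow> i \<inter> j \<noteq> {}"

text \<open>In the following, \<open>C\<^sub>1\<close> and \<open>C\<^sub>2\<close> are the sets of cycles of \<open>\<sigma>\<^sub>1\<close> and \<open>\<sigma>\<^sub>2\<close>. All values of \<open>q\<close>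
  on \<open>C\<^sub>2\<close> are at least 2 where these notions are used, so \<open>q j - 1\<close> is not truncated.\<close>

definition arrangement_of_marriages ::
  "nat set set \<Rightarrow> nat set set \<Rightarrow> (nat set \<Rightarrow> nat) \<Rightarrow> (nat set \<Rightarrow> nat set) \<Rightarrow> bool" where
  "arrangement_of_marriages C\<^sub>1 C\<^sub>2 q M \<longleftrightarrow>
     M \<in> C\<^sub>1 \<rightarrow>\<^sub>E C\<^sub>2 \<and>
     (\<forall>i\<in>C\<^sub>1. intersecting i (M i)) \<and>
     (\<forall>j\<in>C\<^sub>2. card {i\<in>C\<^sub>1. M i = j} = q j - 1)"

definition strict_marriage_condition ::
  "nat set set \<Rightarrow> nat set set \<Rightarrow> (nat set \<Rightarrow> nat) \<Rightarrow> bool" where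
  "strict_marriage_condition C\<^sub>1 C\<^sub>2 q \<longleftrightarrow>
     (\<forall>A. A \<subseteq> C\<^sub>2 \<and> A \<noteq> {} \<and> A \<noteq> C\<^sub>2 \<longrightarrow>
        card {i\<in>C\<^sub>1. intersecting i (\<Union>A)} > (\<Sum>j\<in>A. (q j - 1)))"

definition distinguishing_arrangements ::
  "nat set set \<Rightarrow> nat set set \<Rightarrow> (nat set \<Rightarrow> nat) \<Rightarrow> bool" where
  "distinguishing_arrangements C\<^sub>1 C\<^sub>2 q \<longleftrightarrow>
     (\<forall>A. A \<subseteq> C\<^sub>2 \<and> A \<noteq> {} \<and> A \<noteq> C\<^sub>2 \<longrightarrow>
        (\<exists>M\<^sub>1 M\<^sub>2. arrangement_of_marriages C\<^sub>1 C\<^sub>2 q M\<^sub>1 \<and>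
                 arrangement_of_marriages C\<^sub>1 C\<^sub>2 q M\<^sub>2 \<and>
                 {i\<in>C\<^sub>1. M\<^sub>1 i \<in> A} \<noteq> {i\<in>C\<^sub>1. M\<^sub>2 i \<in> A}))"

text \<open>Only the values \<open>x i j\<close> at intersecting pairs are variables of the system; the others are
  irrelevant.\<close>

definition strictly_positive_solution ::
  "nat set set \<Rightarrow> nat set set \<Rightarrow> (nat set \<Rightarrow> nat) \<Rightarrow> (nat set \<Rightarrow> nat set \<Rightarrow> real) \<Rightarrow> bool" where
  "strictly_positive_solution C\<^sub>1 C\<^sub>2 q x \<longleftrightarrow>
     (\<forall>i\<in>C\<^sub>1. \<forall>j\<in>C\<^sub>2. intersecting i j \<longrightarrow> x i j > 0) \<and>
     (\<forall>i\<in>C\<^sub>1. (\<Sum>j | j \<in> C\<^sub>2 \<and> intersecting i j. x i j) = 1) \<and>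
     (\<forall>j\<in>C\<^sub>2. (\<Sum>i | i \<in> C\<^sub>1 \<and> intersecting i j. x i j) = real (q j) - 1)"

end

theory Submission
  imports Defs
begin

text \<open>Strictness in (e) is exactly the slack in Hall's condition needed to force a prescribed
  intersecting pair into an arrangement of marriages. Since \<open>\<sigma>\<^sub>1 \<circ> \<sigma>\<^sub>2\<close> is a long cycle, the
  intersection graph is connected, so some cycle of \<open>\<sigma>\<^sub>1\<close> meets both \<open>A\<close> and its complement;
  prescribing its wife inside or outside \<open>A\<close> gives two arrangements as in (e\<open>\<^sup>2\<close>), and averaging the
  arrangements forced through all intersecting pairs gives a positive solution as in (e\<open>\<^sup>3\<close>).
  Conversely, if only \<open>\<Sum>\<^bsub>j\<in>A\<^esub> (q j - 1)\<close> cycles met \<open>\<Union>A\<close>, every arrangement (or solution) would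
  have to use all their capacity on \<open>A\<close>.\<close>

section \<open>Hall's theorem and its version with capacities\<close>

text \<open>Halmos-Vaughan induction. A tight proper nonempty \<open>J\<close> is matched separately
  from the rest. If there is none, every proper nonempty subset has a spare neighbour, so one index
  may be matched arbitrarily. Since \<open>card\<close> is 0 on infinite sets, the hypothesis also
  makes each \<open>N i\<close> finite.\<close>

theorem hall_marriage:
  fixes N :: "'a \<Rightarrow> 'b set"
  assumes "finite I"
    and "\<And>J. J \<subseteq> I \<Longrightarrow> card J \<le> card (\<Union> (N ` J))"
  shows "\<exists>f. inj_on f I \<and> (\<forall>i\<in>I. f i \<in> N i)"
  using assms
proof (induction I arbitrary: N rule: finite_psubset_induct)
  case (psubset I)
  note fin = \<open>finite I\<close> and hall = psubset.prems
  show ?case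
  proof (cases "\<exists>J. J \<subset> I \<and> J \<noteq> {} \<and> card (\<Union> (N ` J)) = card J")
    case True
    then obtain J where J: "J \<subset> I" "J \<noteq> {}" "card (\<Union> (N ` J)) = card J"
      by blast
    have finJ: "finite J"
      using J(1) fin finite_subset by blast
    have "\<exists>f. inj_on f J \<and> (\<forall>i\<in>J. f i \<in> N i)"
    proof (rule psubset.IH[OF J(1)])
      show "card K \<le> card (\<Union> (N ` K))" if "K \<subseteq> J" for K
        using that J(1) by (intro hall) blast
    qed
    then obtain f where f: "inj_on f J" "\<forall>i\<in>J. f i \<in> N i"
      by (elim exE conjE)
    let ?N = "\<lambda>i. N i - \<Union> (N ` J)"
    have "\<exists>g. inj_on g (I - J) \<and> (\<forall>i\<in>I - J. g i \<in> ?N i)"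
    proof (rule psubset.IH)
      show "I - J \<subset> I"
        using J by blast
      show "card K \<le> card (\<Union> (?N ` K))" if K: "K \<subseteq> I - J" for K
      proof -
        have KJ: "K \<union> J \<subseteq> I"
          using K J(1) by blast
        have finK: "finite K"
          using KJ fin finite_subset by blast
        \<comment> \<open>Tightness means that \<open>J\<close> accounts for only
          \<open>card J\<close> neighbours, so the condition for \<open>K \<union> J\<close> leaves
          at least \<open>card K\<close> outside them.\<close>
        have "card K + card J = card (K \<union> J)"
          using K finJ finK by (intro card_Un_disjoint[symmetric]) auto
        also have "\<dots> \<le> card (\<Union> (N ` (K \<union> J)))"
          by (rule hall[OF KJ])
        also have "\<Union> (N ` (K \<union> J)) = \<Union> (?N ` K) \<union> \<Union> (N ` J)"
          by auto
        also have "card \<dots> \<le> card (\<Union> (?N ` K)) + card (\<Union> (N ` J))"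
          by (rule card_Un_le)
        finally show ?thesis
          using J(3) by simp
      qed
    qed
    then obtain g where g: "inj_on g (I - J)" "\<forall>i\<in>I - J. g i \<in> ?N i"
      by (elim exE conjE)
    let ?h = "\<lambda>i. if i \<in> J then f i else g i"
    have "f ` J \<inter> g ` (I - J) = {}"
      using f(2) g(2) by fastforce
    then have "inj_on ?h (J \<union> (I - J))"
      by (rule inj_on_disjoint_Un[OF f(1) g(1)])
    then have "inj_on ?h I"
      using J(1) by (simp add: Un_absorb1 psubset_imp_subset)
    moreover have "\<forall>i\<in>I. ?h i \<in> N i"
      using f(2) g(2) by auto
    ultimately show ?thesis
      by (intro exI[of _ ?h] conjI)
  next
    case no_tight: False
    show ?thesis
    proof (cases "I = {}")
      case True
      then show ?thesis by simp
    next
      case False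
      then obtain i where i: "i \<in> I" by blast
      have "card {i} \<le> card (\<Union> (N ` {i}))"
        using i by (intro hall) auto
      then have "N i \<noteq> {}" by auto
      then obtain a where a: "a \<in> N i" by blast
      let ?N = "\<lambda>j. N j - {a}"
      have "\<exists>g. inj_on g (I - {i}) \<and> (\<forall>j\<in>I - {i}. g j \<in> ?N j)"
      proof (rule psubset.IH)
        show "I - {i} \<subset> I"
          using i by blast
        show "card K \<le> card (\<Union> (?N ` K))" if K: "K \<subseteq> I - {i}" for K
        proof (cases "K = {}")
          case True
          then show ?thesis by simp
        next
          case K0: False
          have K': "K \<subset> I"
            using K i by blast
          have "card K \<le> card (\<Union> (N ` K))"
            using K' by (intro hall) auto
          \<comment> \<open>The surplus of one in a non-tight set pays for the removal of
            \<open>a\<close>.\<close>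
          moreover have "card (\<Union> (N ` K)) \<noteq> card K"
            using no_tight K' K0 by blast
          ultimately have "card K < card (\<Union> (N ` K))"
            by simp
          moreover have "card (\<Union> (N ` K)) - 1 \<le> card (\<Union> (N ` K) - {a})"
            using diff_card_le_card_Diff[of "{a}" "\<Union> (N ` K)"] by simp
          moreover have "\<Union> (N ` K) - {a} = \<Union> (?N ` K)"
            by auto
          then have "card (\<Union> (N ` K) - {a}) = card (\<Union> (?N ` K))"
            by (rule arg_cong)
          ultimately show ?thesis
            by linarith
        qed
      qed
      then obtain g where g: "inj_on g (I - {i})" "\<forall>j\<in>I - {i}. g j \<in> ?N j"
        by (elim exE conjE)
      have "a \<notin> g ` (I - {i})"
        using g(2) by blast
      then have "inj_on (g(i := a)) (insert i (I - {i}))"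
        using g(1) unfolding inj_on_insert by (simp add: inj_on_fun_updI)
      then have "inj_on (g(i := a)) I"
        using i by (simp add: insert_absorb)
      moreover have "\<forall>j\<in>I. (g(i := a)) j \<in> N j"
        using a g(2) by auto
      ultimately show ?thesis
        by (intro exI[of _ "g(i := a)"] conjI)
    qed
  qed
qed

text \<open>Each \<open>j\<close> is split into \<open>b j\<close> copies, and the copies choose
  elements of \<open>X\<close> by Hall's theorem. As there are exactly \<open>card X\<close> copies,
  the choice is a bijection, and its inverse followed by forgetting the copy number is
  \<open>M\<close>.\<close>

lemma capacitated_assignment:
  fixes R :: "'a \<Rightarrow> 'b \<Rightarrow> bool" and b :: "'b \<Rightarrow> nat"
  assumes X: "finite X" and Y: "finite Y" and total: "sum b Y = card X"
    and hall: "\<And>A. A \<subseteq> Y \<Longrightarrow> sum b A \<le> card {i \<in> X. \<exists>j\<in>A. R i j}"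
  shows "\<exists>M \<in> X \<rightarrow>\<^sub>E Y. (\<forall>i\<in>X. R i (M i)) \<and> (\<forall>j\<in>Y. card {i \<in> X. M i = j} = b j)"
proof -
  define I where "I = (SIGMA j:Y. {..<b j})"
  define N where "N p = {i \<in> X. R i (fst p)}" for p :: "'b \<times> nat"
  have finI: "finite I"
    using Y by (simp add: I_def)
  have cardI: "card I = card X"
    using Y total by (simp add: I_def)
  have "\<exists>f. inj_on f I \<and> (\<forall>p\<in>I. f p \<in> N p)"
  proof (rule hall_marriage[OF finI])
    show "card J \<le> card (\<Union> (N ` J))" if J: "J \<subseteq> I" for J
    proof -
      have sub: "fst ` J \<subseteq> Y"
        using J by (auto simp: I_def)
      then have fin: "finite (fst ` J)"
        using Y finite_subset by blast
      \<comment> \<open>Copies of the same \<open>j\<close> have the same neighbours, so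
        \<open>J\<close> may be enlarged to all copies of its first components.\<close>
      have "J \<subseteq> (SIGMA j:fst ` J. {..<b j})"
        using J by (force simp: I_def)
      then have "card J \<le> card (SIGMA j:fst ` J. {..<b j})"
        using fin by (intro card_mono) auto
      also have "\<dots> = sum b (fst ` J)"
        using fin by simp
      also have "\<dots> \<le> card {i \<in> X. \<exists>j\<in>fst ` J. R i j}"
        by (rule hall[OF sub])
      also have "{i \<in> X. \<exists>j\<in>fst ` J. R i j} = \<Union> (N ` J)"
        by (auto simp: N_def)
      finally show ?thesis .
    qed
  qed
  then obtain f where inj: "inj_on f I" and fN: "\<And>p. p \<in> I \<Longrightarrow> f p \<in> N p"
    by blast
  have "f ` I \<subseteq> X"
    using fN by (auto simp: N_def)
  moreover have "card (f ` I) = card X"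
    using inj cardI by (simp add: card_image)
  ultimately have surj: "f ` I = X"
    using X by (simp add: card_subset_eq)
  define M where "M = restrict (\<lambda>i. fst (inv_into I f i)) X"
  have Mf: "M (f p) = fst p" if "p \<in> I" for p
    using that inj surj by (auto simp: M_def)
  have M: "M i \<in> Y \<and> R i (M i)" if i: "i \<in> X" for i
  proof -
    obtain p where p: "p \<in> I" "i = f p"
      using i surj by blast
    then show ?thesis
      using Mf[of p] fN[of p] by (auto simp: I_def N_def)
  qed
  have "card {i \<in> X. M i = j} = b j" if j: "j \<in> Y" for j
  proof -
    have "{i \<in> X. M i = j} = f ` ({j} \<times> {..<b j})"
    proof (intro equalityI subsetI)
      fix i assume "i \<in> {i \<in> X. M i = j}"
      then obtain p where "p \<in> I" "i = f p" "fst p = j"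
        using surj Mf by auto
      then show "i \<in> f ` ({j} \<times> {..<b j})"
        by (auto simp: I_def)
    next
      fix i assume "i \<in> f ` ({j} \<times> {..<b j})"
      then obtain p where p: "p \<in> {j} \<times> {..<b j}" "i = f p"
        by blast
      then have "p \<in> I"
        using j by (auto simp: I_def)
      then show "i \<in> {i \<in> X. M i = j}"
        using p Mf surj by auto
    qed
    moreover have "inj_on f ({j} \<times> {..<b j})"
      using j by (intro inj_on_subset[OF inj]) (auto simp: I_def)
    ultimately show ?thesis
      by (simp add: card_image)
  qed
  moreover have "M \<in> X \<rightarrow>\<^sub>E Y"
    using M by (auto simp: M_def)
  ultimately show ?thesis
    using M by blast
qed

section \<open>Arrangements, positive solutions and the strict condition in a bipartite
  graph\<close>

text \<open>Hall's condition is applied to the graph in which \<open>i\<close> has \<open>j\<close> as its only neighbour: sets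
  containing \<open>j\<close> lose no neighbours, all others lose at most one.\<close>

lemma arrangement_through_edge:
  assumes fin: "finite C\<^sub>1" "finite C\<^sub>2" and total: "(\<Sum>j\<in>C\<^sub>2. q j - 1) = card C\<^sub>1"
    and nbr: "\<And>i. i \<in> C\<^sub>1 \<Longrightarrow> \<exists>j\<in>C\<^sub>2. intersecting i j"
    and strict: "strict_marriage_condition C\<^sub>1 C\<^sub>2 q"
    and ij: "i \<in> C\<^sub>1" "j \<in> C\<^sub>2" "intersecting i j"
  shows "\<exists>M. arrangement_of_marriages C\<^sub>1 C\<^sub>2 q M \<and> M i = j"
proof -
  let ?R = "\<lambda>i' j'. intersecting i' j' \<and> (i' = i \<longrightarrow> j' = j)"
  have "\<exists>M \<in> C\<^sub>1 \<rightarrow>\<^sub>E C\<^sub>2. (\<forall>i\<in>C\<^sub>1. ?R i (M i)) \<and> (\<forall>j\<in>C\<^sub>2. card {i \<in> C\<^sub>1. M i = j} = q j - 1)"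
  proof (rule capacitated_assignment[OF fin total])
    fix A assume A: "A \<subseteq> C\<^sub>2"
    let ?N = "{i \<in> C\<^sub>1. intersecting i (\<Union>A)}" and ?N' = "{i' \<in> C\<^sub>1. \<exists>j'\<in>A. ?R i' j'}"
    have N: "?N = {i \<in> C\<^sub>1. \<exists>j\<in>A. intersecting i j}"
      by (auto simp: intersecting_def)
    consider "A = {}" | "A = C\<^sub>2" | "A \<noteq> {}" "A \<noteq> C\<^sub>2"
      by blast
    then show "(\<Sum>j\<in>A. q j - 1) \<le> card ?N'"
    proof cases
      case 1
      then show ?thesis by simp
    next
      \<comment> \<open>Strictness says nothing about all of \<open>C\<^sub>2\<close>. Here
        \<open>i\<close> keeps the neighbour \<open>j\<close>, every other boy keeps all of his, and
        \<open>total\<close> gives equality.\<close>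
      case 2
      then have "?N' = C\<^sub>1"
        using nbr ij by blast
      then show ?thesis
        using 2 total by simp
    next
      case 3
      then have "(\<Sum>j\<in>A. q j - 1) < card ?N"
        using A strict by (simp add: strict_marriage_condition_def)
      \<comment> \<open>Discarding \<open>i\<close> altogether, whether or not \<open>j\<close> lies
        in \<open>A\<close>, costs at most the one neighbour that strictness provides.\<close>
      moreover have "card ?N - 1 \<le> card (?N - {i})"
        using diff_card_le_card_Diff[of "{i}" ?N] by simp
      moreover have "card (?N - {i}) \<le> card ?N'"
        unfolding N using fin by (intro card_mono) auto
      ultimately show ?thesis
        by linarith
    qed
  qed
  then obtain M where M: "M \<in> C\<^sub>1 \<rightarrow>\<^sub>E C\<^sub>2" "\<forall>i\<in>C\<^sub>1. ?R i (M i)"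
    "\<forall>j\<in>C\<^sub>2. card {i \<in> C\<^sub>1. M i = j} = q j - 1"
    by (elim bexE conjE)
  then have "arrangement_of_marriages C\<^sub>1 C\<^sub>2 q M"
    by (simp add: arrangement_of_marriages_def)
  moreover have "M i = j"
    using M(2) ij(1) by simp
  ultimately show ?thesis
    by (intro exI conjI)
qed

text \<open>The husbands of \<open>A\<close> always lie among the neighbours of \<open>A\<close>,
  and their number is the same in every arrangement. Without a surplus of neighbours they would be
  all the neighbours, so no two arrangements could differ on \<open>A\<close>.\<close>

lemma strict_if_distinguishing:
  assumes fin: "finite C\<^sub>1" "finite C\<^sub>2" and dist: "distinguishing_arrangements C\<^sub>1 C\<^sub>2 q"
  shows "strict_marriage_condition C\<^sub>1 C\<^sub>2 q"
  unfolding strict_marriage_condition_def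
proof (intro allI impI)
  fix A assume A: "A \<subseteq> C\<^sub>2 \<and> A \<noteq> {} \<and> A \<noteq> C\<^sub>2"
  let ?N = "{i \<in> C\<^sub>1. intersecting i (\<Union>A)}"
  obtain M\<^sub>1 M\<^sub>2 where arr: "arrangement_of_marriages C\<^sub>1 C\<^sub>2 q M\<^sub>1" "arrangement_of_marriages C\<^sub>1 C\<^sub>2 q M\<^sub>2"
    and neq: "{i\<in>C\<^sub>1. M\<^sub>1 i \<in> A} \<noteq> {i\<in>C\<^sub>1. M\<^sub>2 i \<in> A}"
    using dist[unfolded distinguishing_arrangements_def, rule_format, OF A] by (elim exE conjE)
  have finA: "finite A"
    using A fin finite_subset by blast
  have sub: "{i\<in>C\<^sub>1. M i \<in> A} \<subseteq> ?N" and card: "card {i\<in>C\<^sub>1. M i \<in> A} = (\<Sum>j\<in>A. q j - 1)"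
    if M: "arrangement_of_marriages C\<^sub>1 C\<^sub>2 q M" for M
  proof -
    have "intersecting i (\<Union>A)" if "i \<in> C\<^sub>1" "M i \<in> A" for i
    proof -
      have "intersecting i (M i)"
        using M that(1) by (simp add: arrangement_of_marriages_def)
      then show ?thesis
        using that(2) by (auto simp: intersecting_def)
    qed
    then show "{i\<in>C\<^sub>1. M i \<in> A} \<subseteq> ?N"
      by blast
    have "{i\<in>C\<^sub>1. M i \<in> A} = (\<Union>j\<in>A. {i\<in>C\<^sub>1. M i = j})"
      by auto
    also have "card \<dots> = (\<Sum>j\<in>A. card {i\<in>C\<^sub>1. M i = j})"
      using fin finA by (intro card_UN_disjoint) auto
    also have "\<dots> = (\<Sum>j\<in>A. q j - 1)"
      using M A by (intro sum.cong) (auto simp: arrangement_of_marriages_def)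
    finally show "card {i\<in>C\<^sub>1. M i \<in> A} = (\<Sum>j\<in>A. q j - 1)" .
  qed
  have finN: "finite ?N"
    using fin by simp
  show "(\<Sum>j\<in>A. q j - 1) < card ?N"
  proof (rule ccontr)
    assume le: "\<not> ?thesis"
    have "{i\<in>C\<^sub>1. M i \<in> A} = ?N" if M: "arrangement_of_marriages C\<^sub>1 C\<^sub>2 q M" for M
    proof (rule card_seteq[OF finN sub[OF M]])
      show "card ?N \<le> card {i\<in>C\<^sub>1. M i \<in> A}"
        using le unfolding card[OF M] by (simp only: not_less)
    qed
    from this[OF arr(1)] this[OF arr(2)] show False
      using neq by (simp only: simp_thms)
  qed
qed

text \<open>The 0/1 matrix of an arrangement solves the equations, and averages of solutions are
  solutions. Averaging over one arrangement through each intersecting pair makes every entry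
  positive.\<close>

lemma positive_solution_if_strict:
  assumes fin: "finite C\<^sub>1" "finite C\<^sub>2" and total: "(\<Sum>j\<in>C\<^sub>2. q j - 1) = card C\<^sub>1"
    and ne: "C\<^sub>1 \<noteq> {}"
    and nbr: "\<And>i. i \<in> C\<^sub>1 \<Longrightarrow> \<exists>j\<in>C\<^sub>2. intersecting i j"
    and q: "\<And>j. j \<in> C\<^sub>2 \<Longrightarrow> q j \<ge> 2"
    and strict: "strict_marriage_condition C\<^sub>1 C\<^sub>2 q"
  shows "\<exists>x. strictly_positive_solution C\<^sub>1 C\<^sub>2 q x"
proof -
  define E where "E = {(i, j). i \<in> C\<^sub>1 \<and> j \<in> C\<^sub>2 \<and> intersecting i j}"
  have "\<forall>e\<in>E. \<exists>M. arrangement_of_marriages C\<^sub>1 C\<^sub>2 q M \<and> M (fst e) = snd e"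
    using arrangement_through_edge[OF fin total nbr strict] by (auto simp: E_def)
  then obtain M where M: "\<And>e. e \<in> E \<Longrightarrow> arrangement_of_marriages C\<^sub>1 C\<^sub>2 q (M e)"
    and Me: "\<And>e. e \<in> E \<Longrightarrow> M e (fst e) = snd e"
    by metis
  have finE: "finite E"
    by (rule finite_subset[of _ "C\<^sub>1 \<times> C\<^sub>2"]) (use fin in \<open>auto simp: E_def\<close>)
  have "E \<noteq> {}"
    using ne nbr by (auto simp: E_def)
  then have E0: "real (card E) > 0"
    using finE by (simp add: card_gt_0_iff)
  \<comment> \<open>The average is indexed by pairs, so an arrangement chosen for several pairs
    counts with multiplicity.\<close>
  define x where "x i j = (\<Sum>e\<in>E. of_bool (M e i = j)) / real (card E)" for i j
  have "x i j > 0" if "i \<in> C\<^sub>1" "j \<in> C\<^sub>2" "intersecting i j" for i j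
  proof -
    have e: "(i, j) \<in> E"
      using that by (simp add: E_def)
    have "0 < (\<Sum>e\<in>E. of_bool (M e i = j) :: real)"
      by (rule sum_pos2[OF finE e]) (use Me[OF e] in auto)
    then show ?thesis
      using E0 by (simp add: x_def)
  qed
  moreover have "(\<Sum>j | j \<in> C\<^sub>2 \<and> intersecting i j. x i j) = 1" if i: "i \<in> C\<^sub>1" for i
  proof -
    have "(\<Sum>j | j \<in> C\<^sub>2 \<and> intersecting i j. of_bool (M e i = j) :: real) = 1" if "e \<in> E" for e
    proof -
      have "M e i \<in> {j. j \<in> C\<^sub>2 \<and> intersecting i j}"
        using M[OF that] i by (auto simp: arrangement_of_marriages_def)
      then show ?thesis
        using fin by (simp add: of_bool_def)
    qed
    then show ?thesis
      unfolding x_def sum_divide_distrib[symmetric]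
      by (subst sum.swap) (use E0 in simp)
  qed
  moreover have "(\<Sum>i | i \<in> C\<^sub>1 \<and> intersecting i j. x i j) = real (q j) - 1" if j: "j \<in> C\<^sub>2" for j
  proof -
    have "(\<Sum>i | i \<in> C\<^sub>1 \<and> intersecting i j. of_bool (M e i = j)) = real (q j) - 1" if "e \<in> E" for e
    proof -
      \<comment> \<open>Arrangements marry only intersecting cycles, so restricting the column sum
        to them loses no husband.\<close>
      have "{i. i \<in> C\<^sub>1 \<and> intersecting i j} \<inter> {i. M e i = j} = {i \<in> C\<^sub>1. M e i = j}"
        using M[OF that] by (auto simp: arrangement_of_marriages_def)
      moreover have "card {i \<in> C\<^sub>1. M e i = j} = q j - 1"
        using M[OF that] j by (simp add: arrangement_of_marriages_def)
      ultimately show ?thesis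
        using fin q[OF j] by (simp add: sum_of_bool_eq of_nat_diff)
    qed
    then show ?thesis
      unfolding x_def sum_divide_distrib[symmetric]
      by (subst sum.swap) (use E0 in simp)
  qed
  ultimately show ?thesis
    unfolding strictly_positive_solution_def by blast
qed

text \<open>The total weight on \<open>A\<close> is counted twice: by columns it is the total demand
  of \<open>A\<close>, by rows it is at most 1 per neighbour of \<open>A\<close>. A cycle meeting
  both \<open>A\<close> and its complement, supplied by \<open>conn\<close>, spends some weight
  outside, so the bound is strict.\<close>

lemma strict_if_positive_solution:
  assumes fin: "finite C\<^sub>1" "finite C\<^sub>2"
    and q: "\<And>j. j \<in> C\<^sub>2 \<Longrightarrow> q j \<ge> 2"
    and conn: "\<And>A. A \<subseteq> C\<^sub>2 \<Longrightarrow> A \<noteq> {} \<Longrightarrow> A \<noteq> C\<^sub>2 \<Longrightarrow>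
      \<exists>i\<in>C\<^sub>1. \<exists>a\<in>A. \<exists>b\<in>C\<^sub>2 - A. intersecting i a \<and> intersecting i b"
    and x: "strictly_positive_solution C\<^sub>1 C\<^sub>2 q x"
  shows "strict_marriage_condition C\<^sub>1 C\<^sub>2 q"
  unfolding strict_marriage_condition_def
proof (intro allI impI)
  fix A assume A: "A \<subseteq> C\<^sub>2 \<and> A \<noteq> {} \<and> A \<noteq> C\<^sub>2"
  have finA: "finite A"
    using A fin finite_subset by blast
  have pos: "\<And>i j. i \<in> C\<^sub>1 \<Longrightarrow> j \<in> C\<^sub>2 \<Longrightarrow> intersecting i j \<Longrightarrow> x i j > 0"
    and row: "\<And>i. i \<in> C\<^sub>1 \<Longrightarrow> (\<Sum>j | j \<in> C\<^sub>2 \<and> intersecting i j. x i j) = 1"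
    and col: "\<And>j. j \<in> C\<^sub>2 \<Longrightarrow> (\<Sum>i | i \<in> C\<^sub>1 \<and> intersecting i j. x i j) = real (q j) - 1"
    using x unfolding strictly_positive_solution_def by blast+
  let ?N = "{i \<in> C\<^sub>1. intersecting i (\<Union>A)}"
  obtain i a b where i: "i \<in> C\<^sub>1" "a \<in> A" "b \<in> C\<^sub>2 - A" "intersecting i a" "intersecting i b"
    using conn[of A] A by blast
  have "real (\<Sum>j\<in>A. q j - 1) = (\<Sum>j\<in>A. \<Sum>i | i \<in> C\<^sub>1 \<and> intersecting i j. x i j)"
    unfolding of_nat_sum
  proof (rule sum.cong[OF refl])
    fix j assume "j \<in> A"
    then have "j \<in> C\<^sub>2"
      using A by blast
    then show "real (q j - 1) = (\<Sum>i | i \<in> C\<^sub>1 \<and> intersecting i j. x i j)"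
      using col[of j] q[of j] by (simp add: of_nat_diff)
  qed
  also have "\<dots> = (\<Sum>i\<in>C\<^sub>1. \<Sum>j | j \<in> A \<and> intersecting i j. x i j)"
    by (rule sum.swap_restrict[OF finA fin(1)])
  also have "\<dots> = (\<Sum>i\<in>?N. \<Sum>j | j \<in> A \<and> intersecting i j. x i j)"
  proof (rule sum.mono_neutral_right[OF fin(1)])
    show "\<forall>i\<in>C\<^sub>1 - ?N. (\<Sum>j | j \<in> A \<and> intersecting i j. x i j) = 0"
    proof
      fix i assume "i \<in> C\<^sub>1 - ?N"
      then have "{j. j \<in> A \<and> intersecting i j} = {}"
        by (auto simp: intersecting_def)
      then show "(\<Sum>j | j \<in> A \<and> intersecting i j. x i j) = 0"
        by (simp only: sum.empty)
    qed
  qed auto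
  also have "\<dots> < (\<Sum>i\<in>?N. 1)"
  proof (rule sum_strict_mono_ex1)
    show "\<forall>i\<in>?N. (\<Sum>j | j \<in> A \<and> intersecting i j. x i j) \<le> 1"
    proof
      fix i assume "i \<in> ?N"
      then have iC: "i \<in> C\<^sub>1" by simp
      have "(\<Sum>j | j \<in> A \<and> intersecting i j. x i j) \<le> (\<Sum>j | j \<in> C\<^sub>2 \<and> intersecting i j. x i j)"
        using A fin iC by (intro sum_mono2) (auto intro: less_imp_le[OF pos])
      then show "(\<Sum>j | j \<in> A \<and> intersecting i j. x i j) \<le> 1"
        using row[OF iC] by simp
    qed
    \<comment> \<open>The positive entry at \<open>b\<close>, outside \<open>A\<close>, is missing
      from the left-hand sum.\<close>
    have "(\<Sum>j | j \<in> A \<and> intersecting i j. x i j) < (\<Sum>j | j \<in> C\<^sub>2 \<and> intersecting i j. x i j)"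
      using A fin i by (intro sum_strict_mono2[of _ _ b]) (auto intro: less_imp_le[OF pos] pos)
    moreover have "i \<in> ?N"
      using i by (auto simp: intersecting_def)
    ultimately show "\<exists>i\<in>?N. (\<Sum>j | j \<in> A \<and> intersecting i j. x i j) < 1"
      using row[OF i(1)] by auto
  qed (use fin in simp)
  finally have "real (\<Sum>j\<in>A. q j - 1) < real (card ?N)"
    by (simp only: sum_constant mult_1_right)
  then show "(\<Sum>j\<in>A. q j - 1) < card ?N"
    by (simp only: of_nat_less_iff)
qed

section \<open>The long cycle and connectedness of the intersection graph\<close>

lemma cycle_of_upt:
  assumes "x \<in> {1..k}"
  shows "cycle_of_list [1..<Suc k] x = (if x = k then 1 else Suc x)"
proof -
  let ?cs = "[1..<Suc k]"
  have "map (cycle_of_list ?cs) ?cs = rotate1 ?cs"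
    using cyclic_rotation[of ?cs 1] by simp
  \<comment> \<open>The element \<open>x\<close> sits at index \<open>x - 1\<close>. The index after
    it, taken modulo \<open>k\<close>, wraps to 0 exactly when \<open>x = k\<close>.\<close>
  then have "map (cycle_of_list ?cs) ?cs ! (x - 1) = rotate1 ?cs ! (x - 1)"
    by simp
  moreover have "map (cycle_of_list ?cs) ?cs ! (x - 1) = cycle_of_list ?cs x"
    using assms by (subst nth_map) (auto simp del: upt_Suc)
  moreover have "rotate1 ?cs ! (x - 1) = ?cs ! (Suc (x - 1) mod k)"
    using assms by (subst nth_rotate1) (auto simp del: upt_Suc)
  moreover have "?cs ! (Suc (x - 1) mod k) = (if x = k then 1 else Suc x)"
    using assms by (auto simp del: upt_Suc)
  ultimately show ?thesis
    by simp
qed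

lemma orbit_eq_if_mem:
  assumes "f permutes S" "finite S" "y \<in> orbit f x"
  shows "orbit f y = orbit f x"
  using assms by (intro orbit_cyclic_eq3 cyclic_on_orbit)

text \<open>An \<open>orbit\<close> is generated from \<open>f x\<close>, not from \<open>x\<close>;
  a permutation of a finite set eventually returns to \<open>x\<close>.\<close>

lemma mem_orbit_self:
  assumes "f permutes S" "finite S"
  shows "x \<in> orbit f x"
  using assms by (intro permutation_self_in_orbit) (auto simp: permutation_permutes)

text \<open>If no cycle of \<open>\<sigma>\<^sub>1\<close> met both \<open>A\<close> and its
  complement, the union of \<open>A\<close> would be closed under \<open>\<sigma>\<^sub>1\<close>
  and \<open>\<sigma>\<^sub>2\<close>, hence under the long cycle, and would be all of
  \<open>{1..k}\<close>.\<close>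

lemma intersection_graph_connected:
  assumes p: "\<sigma>\<^sub>1 permutes {1..k}" "\<sigma>\<^sub>2 permutes {1..k}"
    and comp: "\<sigma>\<^sub>1 \<circ> \<sigma>\<^sub>2 = cycle_of_list [1..<Suc k]"
    and A: "A \<subseteq> cycles k \<sigma>\<^sub>2" "A \<noteq> {}" "A \<noteq> cycles k \<sigma>\<^sub>2"
  shows "\<exists>i\<in>cycles k \<sigma>\<^sub>1. \<exists>a\<in>A. \<exists>b\<in>cycles k \<sigma>\<^sub>2 - A. intersecting i a \<and> intersecting i b"
proof (rule ccontr)
  assume contra: "\<not> ?thesis"
  define U where "U = \<Union>A"
  note self = mem_orbit_self[OF p(1) finite_atLeastAtMost] mem_orbit_self[OF p(2) finite_atLeastAtMost]
  \<comment> \<open>Orbits are disjoint or equal, so statements about sets of cycles turn into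
    statements about points.\<close>
  have U_iff: "x \<in> U \<longleftrightarrow> orbit \<sigma>\<^sub>2 x \<in> A" for x
  proof
    assume "x \<in> U"
    then obtain a where a: "a \<in> A" "x \<in> a"
      by (auto simp: U_def)
    then obtain y where "a = orbit \<sigma>\<^sub>2 y"
      using A(1) by (auto simp: cycles_def)
    then show "orbit \<sigma>\<^sub>2 x \<in> A"
      using a orbit_eq_if_mem[OF p(2), of x y] by simp
  qed (use self in \<open>auto simp: U_def\<close>)
  have sub: "U \<subseteq> {1..k}"
    using A(1) permutes_orbit_subset[OF p(2)] by (fastforce simp: U_def cycles_def)
  have inv2: "\<sigma>\<^sub>2 x \<in> U" if "x \<in> U" for x
    using that U_iff orbit_eq_if_mem[OF p(2) _ orbit.base, of x] by simp
  \<comment> \<open>A step of \<open>\<sigma>\<^sub>1\<close> leaving \<open>U\<close> stays in one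
    cycle of \<open>\<sigma>\<^sub>1\<close>, which would then meet a cycle in \<open>A\<close> and
    one outside it.\<close>
  have inv1: "\<sigma>\<^sub>1 x \<in> U" if "x \<in> U" for x
  proof (rule ccontr)
    assume out: "\<sigma>\<^sub>1 x \<notin> U"
    have x: "x \<in> {1..k}" and x': "\<sigma>\<^sub>1 x \<in> {1..k}"
      using that sub permutes_in_image[OF p(1)] by auto
    have "orbit \<sigma>\<^sub>1 x \<in> cycles k \<sigma>\<^sub>1" "orbit \<sigma>\<^sub>2 x \<in> A" "orbit \<sigma>\<^sub>2 (\<sigma>\<^sub>1 x) \<in> cycles k \<sigma>\<^sub>2 - A"
      using x x' out that U_iff unfolding cycles_def by blast+
    moreover have "intersecting (orbit \<sigma>\<^sub>1 x) (orbit \<sigma>\<^sub>2 x)"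
      "intersecting (orbit \<sigma>\<^sub>1 x) (orbit \<sigma>\<^sub>2 (\<sigma>\<^sub>1 x))"
      unfolding intersecting_def using self orbit.base[of \<sigma>\<^sub>1 x] by blast+
    ultimately show False
      using contra by blast
  qed
  have step: "(if x = k then 1 else Suc x) \<in> U" if "x \<in> U" for x
  proof -
    have "cycle_of_list [1..<Suc k] x \<in> U"
      using inv1[OF inv2[OF that]] comp by (metis comp_apply)
    then show ?thesis
      using that sub cycle_of_upt[of x k] by auto
  qed
  have up: "n \<in> U" if "m \<in> U" "m \<le> n" "n \<le> k" for m n
    using that(2,3,1)
  proof (induction n rule: dec_induct)
    case (step n)
    then show ?case
      using \<open>\<And>x. x \<in> U \<Longrightarrow> (if x = k then 1 else Suc x) \<in> U\<close>[of n] by auto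
  qed
  obtain a where "a \<in> A"
    using A(2) by blast
  moreover from this obtain y where "a = orbit \<sigma>\<^sub>2 y"
    using A(1) by (auto simp: cycles_def)
  ultimately have y: "y \<in> U"
    using U_iff by simp
  \<comment> \<open>From any point of \<open>U\<close> the successor map climbs to \<open>k\<close>,
    wraps to 1, and climbs through everything.\<close>
  then have "k \<in> U"
    using up[of y k] sub by auto
  then have "1 \<in> U"
    using step[of k] by simp
  then have "{1..k} \<subseteq> U"
    using up[of 1] by auto
  then have "cycles k \<sigma>\<^sub>2 \<subseteq> A"
    using U_iff by (auto simp: cycles_def)
  then show False
    using A by blast
qed

section \<open>Counting by values of \<open>q\<close>, and the two equivalences\<close>

lemma sum_by_value_multiplicity:
  fixes q s g :: "_ \<Rightarrow> nat"
  assumes C: "finite C" and fin: "finite {i. i \<ge> 2 \<and> s i \<noteq> 0}"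
    and q: "q \<in> C \<rightarrow> {2..}"
    and mult: "\<And>i. i \<ge> 2 \<Longrightarrow> card {j \<in> C. q j = i} = s i"
  shows "(\<Sum>j\<in>C. g (q j)) = (\<Sum>i | i \<ge> 2 \<and> s i \<noteq> 0. g i * s i)"
proof -
  let ?T = "{i. i \<ge> 2 \<and> s i \<noteq> 0}"
  have "q ` C \<subseteq> ?T"
  proof
    fix i assume "i \<in> q ` C"
    then obtain j where j: "j \<in> C" "i = q j" by blast
    then have "i \<ge> 2"
      using q by auto
    moreover have "j \<in> {j \<in> C. q j = i}"
      using j by simp
    then have "card {j \<in> C. q j = i} \<noteq> 0"
      using C by (subst card_0_eq) auto
    ultimately show "i \<in> ?T"
      using mult by simp
  qed
  then have "(\<Sum>j\<in>C. g (q j)) = (\<Sum>i\<in>?T. \<Sum>j\<in>{j \<in> C. q j = i}. g (q j))"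
    by (rule sum.group[OF C fin, symmetric])
  also have "\<dots> = (\<Sum>i\<in>?T. g i * s i)"
    using mult by (intro sum.cong) auto
  finally show ?thesis .
qed

theorem proposition5:
  fixes k :: nat
    and s :: "nat \<Rightarrow> nat"
    and \<sigma>\<^sub>1 \<sigma>\<^sub>2 :: "nat \<Rightarrow> nat"
    and q :: "nat set \<Rightarrow> nat"
  assumes "k \<ge> 1"
    and "finite {i. i \<ge> 2 \<and> s i \<noteq> 0}"
    and "\<sigma>\<^sub>1 permutes {1..k}" and "\<sigma>\<^sub>2 permutes {1..k}"
    and "\<sigma>\<^sub>1 \<circ> \<sigma>\<^sub>2 = cycle_of_list [1..<Suc k]"
    and "card (cycles k \<sigma>\<^sub>2) = (\<Sum>i | i \<ge> 2 \<and> s i \<noteq> 0. s i)"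
    and "card (cycles k \<sigma>\<^sub>1) + card (cycles k \<sigma>\<^sub>2) = (\<Sum>i | i \<ge> 2 \<and> s i \<noteq> 0. i * s i)"
    and "q \<in> cycles k \<sigma>\<^sub>2 \<rightarrow> {2..}"
    and "\<And>i. i \<ge> 2 \<Longrightarrow> card {j \<in> cycles k \<sigma>\<^sub>2. q j = i} = s i"
  shows "(strict_marriage_condition (cycles k \<sigma>\<^sub>1) (cycles k \<sigma>\<^sub>2) q \<longleftrightarrow>
            distinguishing_arrangements (cycles k \<sigma>\<^sub>1) (cycles k \<sigma>\<^sub>2) q) \<and>
         (strict_marriage_condition (cycles k \<sigma>\<^sub>1) (cycles k \<sigma>\<^sub>2) q \<longleftrightarrow>
            (\<exists>x. strictly_positive_solution (cycles k \<sigma>\<^sub>1) (cycles k \<sigma>\<^sub>2) q x))"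
proof -
  let ?C\<^sub>1 = "cycles k \<sigma>\<^sub>1" and ?C\<^sub>2 = "cycles k \<sigma>\<^sub>2"
  have fin: "finite ?C\<^sub>1" "finite ?C\<^sub>2"
    by (simp_all add: cycles_def)
  have q: "q j \<ge> 2" if "j \<in> ?C\<^sub>2" for j
    using assms(8) that by auto
  have ne: "?C\<^sub>1 \<noteq> {}"
    using assms(1) by (auto simp: cycles_def)
  have nbr: "\<exists>j\<in>?C\<^sub>2. intersecting i j" if i: "i \<in> ?C\<^sub>1" for i
  proof -
    obtain x where x: "x \<in> {1..k}" "i = orbit \<sigma>\<^sub>1 x"
      using i by (auto simp: cycles_def)
    then have "intersecting i (orbit \<sigma>\<^sub>2 x)"
      using mem_orbit_self[OF assms(3)] mem_orbit_self[OF assms(4)] by (auto simp: intersecting_def)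
    then show ?thesis
      using x by (auto simp: cycles_def)
  qed
  \<comment> \<open>Subtracting 1 for each girl in condition (c) shows that the girls together want
    exactly as many husbands as there are boys. The bound on \<open>q\<close> keeps
    \<open>q j - 1\<close> from being truncated.\<close>
  have total: "(\<Sum>j\<in>?C\<^sub>2. q j - 1) = card ?C\<^sub>1"
  proof -
    have "(\<Sum>j\<in>?C\<^sub>2. q j) = card ?C\<^sub>1 + card ?C\<^sub>2"
      using sum_by_value_multiplicity[OF fin(2) assms(2,8,9), of "\<lambda>i. i"] assms(7) by simp
    moreover have "(\<Sum>j\<in>?C\<^sub>2. q j) = (\<Sum>j\<in>?C\<^sub>2. (q j - 1) + 1)"
      using q by (intro sum.cong) fastforce+
    ultimately show ?thesis
      by (simp add: sum_Suc)
  qed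
  note conn = intersection_graph_connected[OF assms(3,4,5)]
  have "distinguishing_arrangements ?C\<^sub>1 ?C\<^sub>2 q" if strict: "strict_marriage_condition ?C\<^sub>1 ?C\<^sub>2 q"
    unfolding distinguishing_arrangements_def
  proof (intro allI impI)
    fix A assume A: "A \<subseteq> ?C\<^sub>2 \<and> A \<noteq> {} \<and> A \<noteq> ?C\<^sub>2"
    then obtain i a b where i: "i \<in> ?C\<^sub>1" "a \<in> A" "b \<in> ?C\<^sub>2 - A" "intersecting i a" "intersecting i b"
      using conn[of A] by blast
    note edge = arrangement_through_edge[OF fin total nbr strict i(1)]
    obtain M\<^sub>1 where M\<^sub>1: "arrangement_of_marriages ?C\<^sub>1 ?C\<^sub>2 q M\<^sub>1" "M\<^sub>1 i = a"
      using edge[of a] i A by blast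
    obtain M\<^sub>2 where M\<^sub>2: "arrangement_of_marriages ?C\<^sub>1 ?C\<^sub>2 q M\<^sub>2" "M\<^sub>2 i = b"
      using edge[of b] i by blast
    \<comment> \<open>The cycle \<open>i\<close> separates the two sets: its wife is
      \<open>a\<close>, inside \<open>A\<close>, in one arrangement and \<open>b\<close>, outside
      \<open>A\<close>, in the other.\<close>
    have "{i\<in>?C\<^sub>1. M\<^sub>1 i \<in> A} \<noteq> {i\<in>?C\<^sub>1. M\<^sub>2 i \<in> A}"
      using M\<^sub>1(2) M\<^sub>2(2) i by blast
    then show "\<exists>M\<^sub>1 M\<^sub>2. arrangement_of_marriages ?C\<^sub>1 ?C\<^sub>2 q M\<^sub>1 \<and>
        arrangement_of_marriages ?C\<^sub>1 ?C\<^sub>2 q M\<^sub>2 \<and>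
        {i\<in>?C\<^sub>1. M\<^sub>1 i \<in> A} \<noteq> {i\<in>?C\<^sub>1. M\<^sub>2 i \<in> A}"
      using M\<^sub>1(1) M\<^sub>2(1) by blast
  qed
  moreover have "\<exists>x. strictly_positive_solution ?C\<^sub>1 ?C\<^sub>2 q x"
    if "strict_marriage_condition ?C\<^sub>1 ?C\<^sub>2 q"
    using fin total ne nbr q that by (rule positive_solution_if_strict)
  moreover have "strict_marriage_condition ?C\<^sub>1 ?C\<^sub>2 q"
    if "strictly_positive_solution ?C\<^sub>1 ?C\<^sub>2 q x" for x
    using fin q conn that by (rule strict_if_positive_solution)
  ultimately show ?thesis
    using strict_if_distinguishing[OF fin] by metis
qed

end
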